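(* Let $X \xrightarrow{f} Z \xleftarrow{g} Y$ be continuous maps. Then $$\mathrm{TC}_H(f,g)\le \min\{\mathrm{TC}_H(f),\,\mathrm{TC}_H(g)\}.$$
   Context: All maps are continuous, $I=[0,1]$, and $Z^I$ is the path space with the compact-open topology. For maps $f\colon X\to Z$, $g\colon Y\to Z$, a subset $A\subseteq X\times Y$ is $(f,g)$-sectional if there is a continuous map $\sigma\colon A\to Z^I$ with $\sigma(x,y)(0)=f(x)$ and $\sigma(x,y)(1)=g(y)$ for all $(x,y)\in A$. The homotopy bivariate topological complexity $\mathrm{TC}_H(f,g)$ is the least integer $k\ge 0$ such that $X\times Y$ can be covered by $k+1$ open $(f,g)$-sectional subsets, and $\infty$ if no such $k$ exists. For a single map $f\colon X\to Z$, $\mathrm{TC}_H(f):=\mathrm{TC}_H(f,\mathrm{id}_Z)$. *)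

theory Defs
  imports "HOL-Analysis.Analysis"
begin

text \<open>Continuous maps are represented by functions that are \<^const>\<open>undefined\<close> outside the
  domain, so that two points of the mapping space are equal iff they agree as maps.\<close>

definition cont_maps :: "'a topology \<Rightarrow> 'b topology \<Rightarrow> ('a \<Rightarrow> 'b) set" where
  "cont_maps X Y = {h \<in> extensional (topspace X). continuous_map X Y h}"

definition compact_open_topology :: "'a topology \<Rightarrow> 'b topology \<Rightarrow> ('a \<Rightarrow> 'b) topology" where
  "compact_open_topology X Y =
     topology_generated_by
       {{h \<in> cont_maps X Y. h ` K \<subseteq> U} | K U. compactin X K \<and> openin Y U}"

lemma topspace_compact_open_topology: "topspace (compact_open_topology X Y) = cont_maps X Y"
proof -
  have "cont_maps X Y \<in> {{h \<in> cont_maps X Y. h ` K \<subseteq> U} | K U. compactin X K \<and> openin Y U}"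
    by (rule CollectI, rule exI[of _ "{}"], rule exI[of _ "{}"]) auto
  then show ?thesis
    unfolding compact_open_topology_def topology_generated_by_topspace by blast
qed

definition path_space :: "'c topology \<Rightarrow> (real \<Rightarrow> 'c) topology" where
  "path_space Z = compact_open_topology (top_of_set {0..1}) Z"

definition sectional ::
  "'a topology \<Rightarrow> 'b topology \<Rightarrow> 'c topology \<Rightarrow> ('a \<Rightarrow> 'c) \<Rightarrow> ('b \<Rightarrow> 'c) \<Rightarrow> ('a \<times> 'b) set \<Rightarrow> bool"
where
  "sectional X Y Z f g A \<longleftrightarrow>
     A \<subseteq> topspace X \<times> topspace Y \<and>
     (\<exists>\<sigma>. continuous_map (subtopology (prod_topology X Y) A) (path_space Z) \<sigma> \<and>
          (\<forall>(x, y)\<in>A. \<sigma> (x, y) 0 = f x \<and> \<sigma> (x, y) 1 = g y))"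

definition sectional_cover ::
  "'a topology \<Rightarrow> 'b topology \<Rightarrow> 'c topology \<Rightarrow> ('a \<Rightarrow> 'c) \<Rightarrow> ('b \<Rightarrow> 'c) \<Rightarrow> nat \<Rightarrow> bool"
where
  "sectional_cover X Y Z f g k \<longleftrightarrow>
     (\<exists>U :: nat \<Rightarrow> ('a \<times> 'b) set.
        (\<forall>i\<le>k. openin (prod_topology X Y) (U i) \<and> sectional X Y Z f g (U i)) \<and>
        (\<Union>i\<le>k. U i) = topspace X \<times> topspace Y)"

definition TC_H ::
  "'a topology \<Rightarrow> 'b topology \<Rightarrow> 'c topology \<Rightarrow> ('a \<Rightarrow> 'c) \<Rightarrow> ('b \<Rightarrow> 'c) \<Rightarrow> enat"
where
  "TC_H X Y Z f g =
     (if \<exists>k. sectional_cover X Y Z f g k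
      then enat (LEAST k. sectional_cover X Y Z f g k) else \<infinity>)"

definition TC_H_map :: "'a topology \<Rightarrow> 'c topology \<Rightarrow> ('a \<Rightarrow> 'c) \<Rightarrow> enat" where
  "TC_H_map X Z f = TC_H X Z Z f id"

end

theory Submission
  imports Defs
begin

text \<open>Two properties of bivariate topological complexity carry the proof. First, it does not
  increase when the two maps are precomposed with continuous maps \<open>p\<close> and \<open>q\<close>: pull an open
  sectional cover back along \<open>p \<times> q\<close> and precompose its sections with \<open>p \<times> q\<close>
  (\<open>TC_H_compose_le\<close>). Second, it is symmetric in the two maps: pull back along the
  coordinate swap and reverse the paths, path reversal being continuous in the compact-open
  topology (\<open>TC_H_commute_le\<close>). Since \<open>g = id \<circ> g\<close>, the first property gives
  \<open>TC_H(f, g) \<le> TC_H(f, id)\<close>; with the second, \<open>TC_H(f, g) \<le> TC_H(g, f) \<le> TC_H(g, id)\<close>.\<close>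

lemma continuous_map_precompose_compact_open:
  assumes p: "continuous_map W X p"
  shows "continuous_map (compact_open_topology X Z) (compact_open_topology W Z)
           (\<lambda>h. restrict (h \<circ> p) (topspace W))"
proof -
  let ?P = "\<lambda>h. restrict (h \<circ> p) (topspace W)"
  let ?B = "{{h \<in> cont_maps W Z. h ` K \<subseteq> U} | K U. compactin W K \<and> openin Z U}"
  have maps: "?P h \<in> cont_maps W Z" if "h \<in> cont_maps X Z" for h
  proof -
    have "continuous_map W Z (h \<circ> p)"
      using p that by (auto simp: cont_maps_def intro: continuous_map_compose)
    then have "continuous_map W Z (?P h)"
      by (rule continuous_map_eq) simp
    then show ?thesis
      by (simp add: cont_maps_def)
  qed
  have "openin (compact_open_topology X Z) (?P -` S \<inter> topspace (compact_open_topology X Z))"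
    if SB: "S \<in> ?B" for S
  proof -
    obtain K U where S: "S = {h \<in> cont_maps W Z. h ` K \<subseteq> U}"
      and K: "compactin W K" and U: "openin Z U"
      using SB by blast
    have KW: "K \<subseteq> topspace W"
      using K by (rule compactin_subset_topspace)
    have "?P h \<in> S \<longleftrightarrow> h ` (p ` K) \<subseteq> U" if "h \<in> cont_maps X Z" for h
    proof -
      have "?P h ` K = h ` (p ` K)"
        unfolding image_image by (rule image_cong) (use KW in auto)
      then show ?thesis
        using maps[OF that] by (simp add: S)
    qed
    then have "?P -` S \<inter> topspace (compact_open_topology X Z)
                 = {h \<in> cont_maps X Z. h ` (p ` K) \<subseteq> U}"
      unfolding topspace_compact_open_topology by blast
    moreover have "openin (compact_open_topology X Z) {h \<in> cont_maps X Z. h ` (p ` K) \<subseteq> U}"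
      unfolding compact_open_topology_def
      by (rule topology_generated_by_Basis) (use image_compactin[OF K p] U in blast)
    ultimately show ?thesis
      by simp
  qed
  moreover have "?P ` topspace (compact_open_topology X Z) \<subseteq> \<Union>?B"
  proof -
    have "\<Union>?B = cont_maps W Z"
      using topspace_compact_open_topology[of W Z]
      unfolding compact_open_topology_def topology_generated_by_topspace .
    then show ?thesis
      using maps unfolding topspace_compact_open_topology by (simp only: image_subset_iff) blast
  qed
  ultimately show ?thesis
    unfolding compact_open_topology_def[of W Z]
    by (rule continuous_on_generated_topo)
qed

text \<open>The restriction to the unit interval is what makes the reversed path extensional, hence
  a point of the path space.\<close>

definition reverse_path :: "(real \<Rightarrow> 'c) \<Rightarrow> real \<Rightarrow> 'c" where
  "reverse_path \<gamma> = restrict (\<gamma> \<circ> (\<lambda>t. 1 - t)) {0..1}"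

lemma reverse_path_ends [simp]:
  "reverse_path \<gamma> 0 = \<gamma> 1" "reverse_path \<gamma> 1 = \<gamma> 0"
  by (simp_all add: reverse_path_def)

lemma continuous_map_reverse_path:
  "continuous_map (path_space Z) (path_space Z) reverse_path"
proof -
  have "continuous_map (top_of_set {0..1::real}) (top_of_set {0..1}) (\<lambda>t. 1 - t)"
    by (auto intro!: continuous_intros)
  from continuous_map_precompose_compact_open[OF this, of Z] show ?thesis
    by (simp add: path_space_def reverse_path_def[abs_def])
qed

text \<open>The common form of both properties: sectional covers are pulled back along \<open>r\<close>, and
  their sections are composed with an operation \<open>\<rho>\<close> on paths that corrects the endpoints.\<close>

lemma sectional_cover_pullback:
  assumes cover: "sectional_cover X Y Z f g k"
    and r: "continuous_map (prod_topology X' Y') (prod_topology X Y) r"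
    and \<rho>: "continuous_map (path_space Z) (path_space Z) \<rho>"
    and ends: "\<And>x y \<gamma>. x \<in> topspace X' \<Longrightarrow> y \<in> topspace Y' \<Longrightarrow>
                 \<gamma> 0 = f (fst (r (x, y))) \<Longrightarrow> \<gamma> 1 = g (snd (r (x, y))) \<Longrightarrow>
                 \<rho> \<gamma> 0 = f' x \<and> \<rho> \<gamma> 1 = g' y"
  shows "sectional_cover X' Y' Z f' g' k"
proof -
  let ?P = "prod_topology X Y" and ?P' = "prod_topology X' Y'"
  obtain U where U: "\<And>i. i \<le> k \<Longrightarrow> openin ?P (U i)"
      "\<And>i. i \<le> k \<Longrightarrow> sectional X Y Z f g (U i)"
    and cov: "(\<Union>i\<le>k. U i) = topspace X \<times> topspace Y"
    using cover unfolding sectional_cover_def by blast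
  define V where "V i = {w \<in> topspace ?P'. r w \<in> U i}" for i
  have "openin ?P' (V i)" if "i \<le> k" for i
    unfolding V_def using r U(1)[OF that] by (rule openin_continuous_map_preimage)
  moreover have "sectional X' Y' Z f' g' (V i)" if i: "i \<le> k" for i
  proof -
    obtain \<sigma> where \<sigma>: "continuous_map (subtopology ?P (U i)) (path_space Z) \<sigma>"
      and \<sigma>_ends: "\<And>x y. (x, y) \<in> U i \<Longrightarrow> \<sigma> (x, y) 0 = f x \<and> \<sigma> (x, y) 1 = g y"
      using U(2)[OF i] unfolding sectional_def by blast
    have "continuous_map (subtopology ?P' (V i)) (subtopology ?P (U i)) r"
      using r by (auto simp: continuous_map_in_subtopology V_def
          intro: continuous_map_from_subtopology)
    then have "continuous_map (subtopology ?P' (V i)) (path_space Z) (\<rho> \<circ> (\<sigma> \<circ> r))"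
      using \<sigma> \<rho> by (intro continuous_map_compose)
    moreover have "(\<rho> \<circ> (\<sigma> \<circ> r)) (x, y) 0 = f' x \<and> (\<rho> \<circ> (\<sigma> \<circ> r)) (x, y) 1 = g' y"
      if "(x, y) \<in> V i" for x y
      using that \<sigma>_ends[of "fst (r (x, y))" "snd (r (x, y))"] ends[of x y "\<sigma> (r (x, y))"]
      by (simp add: V_def)
    moreover have "V i \<subseteq> topspace X' \<times> topspace Y'"
      by (auto simp: V_def)
    ultimately show ?thesis
      unfolding sectional_def by (intro conjI exI[of _ "\<rho> \<circ> (\<sigma> \<circ> r)"]) auto
  qed
  moreover have "(\<Union>i\<le>k. V i) = topspace X' \<times> topspace Y'"
  proof -
    have "r w \<in> (\<Union>i\<le>k. U i)" if "w \<in> topspace ?P'" for w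
      using continuous_map_image_subset_topspace[OF r] that unfolding cov by auto
    then show ?thesis
      unfolding V_def by auto
  qed
  ultimately show ?thesis
    unfolding sectional_cover_def by (intro exI[of _ V]) simp
qed

lemma TC_H_le_if_sectional_cover:
  assumes "\<And>k. sectional_cover X Y Z f g k \<Longrightarrow> sectional_cover X' Y' Z' f' g' k"
  shows "TC_H X' Y' Z' f' g' \<le> TC_H X Y Z f g"
proof (cases "\<exists>k. sectional_cover X Y Z f g k")
  case True
  then have cover': "sectional_cover X' Y' Z' f' g' (LEAST k. sectional_cover X Y Z f g k)"
    by (rule assms[OF LeastI_ex])
  then have "(LEAST k. sectional_cover X' Y' Z' f' g' k) \<le> (LEAST k. sectional_cover X Y Z f g k)"
    by (rule Least_le)
  moreover have "\<exists>k. sectional_cover X' Y' Z' f' g' k"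
    using cover' by (rule exI)
  ultimately show ?thesis
    unfolding TC_H_def using True by (simp only: if_True enat_ord_simps)
next
  case False
  then have "TC_H X Y Z f g = \<infinity>"
    unfolding TC_H_def by (rule if_not_P)
  then show ?thesis
    by simp
qed

lemma TC_H_compose_le:
  assumes "continuous_map X' X p" and "continuous_map Y' Y q"
  shows "TC_H X' Y' Z (f \<circ> p) (g \<circ> q) \<le> TC_H X Y Z f g"
proof (rule TC_H_le_if_sectional_cover)
  fix k
  assume "sectional_cover X Y Z f g k"
  then show "sectional_cover X' Y' Z (f \<circ> p) (g \<circ> q) k"
  proof (rule sectional_cover_pullback)
    show "continuous_map (prod_topology X' Y') (prod_topology X Y) (\<lambda>(x, y). (p x, q y))"
      using assms by (simp add: continuous_map_prod_top)
    show "continuous_map (path_space Z) (path_space Z) id"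
      by simp
  qed simp
qed

text \<open>Applied twice, this inequality is the symmetry of the invariant.\<close>

lemma TC_H_commute_le: "TC_H X Y Z f g \<le> TC_H Y X Z g f"
proof (rule TC_H_le_if_sectional_cover)
  fix k
  assume "sectional_cover Y X Z g f k"
  then show "sectional_cover X Y Z f g k"
  proof (rule sectional_cover_pullback)
    show "continuous_map (prod_topology X Y) (prod_topology Y X) (\<lambda>(x, y). (y, x))"
      using homeomorphic_map_swap homeomorphic_imp_continuous_map by blast
    show "continuous_map (path_space Z) (path_space Z) reverse_path"
      by (rule continuous_map_reverse_path)
  qed simp
qed

theorem proposition8p1:
  fixes X :: "'a topology" and Y :: "'b topology" and Z :: "'c topology"
    and f :: "'a \<Rightarrow> 'c" and g :: "'b \<Rightarrow> 'c"
  assumes "continuous_map X Z f" and "continuous_map Y Z g"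
  shows "TC_H X Y Z f g \<le> min (TC_H_map X Z f) (TC_H_map Y Z g)"
proof -
  have "TC_H X Y Z f g \<le> TC_H_map X Z f"
    using TC_H_compose_le[of X X id Y Z g Z f id] assms(2) by (simp add: TC_H_map_def)
  moreover have "TC_H Y X Z g f \<le> TC_H_map Y Z g"
    using TC_H_compose_le[of Y Y id X Z f Z g id] assms(1) by (simp add: TC_H_map_def)
  ultimately show ?thesis
    using TC_H_commute_le[of X Y Z f g] by (meson min.boundedI order_trans)
qed

end
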